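(* Let $\langle \mathbf{A},m\rangle$ be a monotonic distributive semilattice. Then the structure $\langle \mathrm{Up}(X(\mathbf{A})),\cap,m_{R_m},X(\mathbf{A})\rangle$ is a monotonic distributive semilattice, and the map $\beta\colon A\to \mathrm{Up}(X(\mathbf{A}))$, $\beta(a)=\{P\in X(\mathbf{A}): a\in P\}$, is an injective homomorphism of monotonic distributive semilattices.
   Context: A semilattice is an algebra $\langle A,\wedge,1\rangle$ with $\wedge$ idempotent, commutative, associative and $a\wedge 1=a$; its natural order is $a\le b$ iff $a\wedge b=a$. A filter is an upset containing $1$ and closed under $\wedge$. A filter $F$ is irreducible if it is proper and whenever $F=F_1\cap F_2$ for filters $F_1,F_2$ then $F=F_1$ or $F=F_2$. An order ideal is a downset $I$ such that for all $a,b\in I$ there is $c\in I$ with $a,b\le c$. A semilattice is distributive if whenever $a\wedge b\le c$ there exist $a_1\ge a$, $b_1\ge b$ with $c=a_1\wedge b_1$. $X(\mathbf{A})$ is the set of irreducible filters of $\mathbf{A}$, $\beta(a)=\{P\in X(\mathbf{A}):a\in P\}$, and $\mathcal{T}_{\mathbf{A}}$ is the topology on $X(\mathbf{A})$ generated by the basis $\{X(\mathbf{A})-\beta(a):a\in A\}$. For a topological space $X$: $\mathcal{KO}(X)$ is the set of compact open subsets; a set $Z\subseteq X$ belongs to $\mathcal{S}(X)$ if $Z=\bigcap\mathcal{L}$ for some family $\mathcal{L}\subseteq\mathcal{KO}(X)$ that is dually directed (for $U,V\in\mathcal{L}$ there is $W\in\mathcal{L}$ with $W\subseteq U\cap V$).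 $\mathrm{Up}(X(\mathbf{A}))$ is the set of subsets of $X(\mathbf{A})$ that are upward closed under inclusion of filters. A monotonic distributive semilattice is a pair $\langle\mathbf{A},m\rangle$ with $\mathbf{A}$ a distributive semilattice and $m\colon A\to A$ satisfying $a\le b\Rightarrow ma\le mb$; a homomorphism of monotonic distributive semilattices is a map preserving $\wedge$, $1$ and commuting with $m$. For $P\in X(\mathbf{A})$ let $m^{-1}(P)=\{a\in A: ma\in P\}$; for $Z\in\mathcal{S}(X(\mathbf{A}))$ let $I_{\mathbf{A}}(Z)=\{a\in A:\beta(a)\cap Z=\emptyset\}$. The multirelation $R_m\subseteq X(\mathbf{A})\times \mathcal{S}(X(\mathbf{A}))$ is defined by $(P,Z)\in R_m$ iff $m^{-1}(P)\cap I_{\mathbf{A}}(Z)=\emptyset$, and for $U\subseteq X(\mathbf{A})$, $m_{R_m}(U)=\{P\in X(\mathbf{A}): \forall Z\ ((P,Z)\in R_m\Rightarrow Z\cap U\neq\emptyset)\}$. *)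

theory Defs
  imports "HOL-Analysis.Abstract_Topology"
begin

locale meet_semilattice =
  fixes A :: "'a set" and meet :: "'a \<Rightarrow> 'a \<Rightarrow> 'a" and one :: 'a
  assumes meet_closed: "\<lbrakk>a \<in> A; b \<in> A\<rbrakk> \<Longrightarrow> meet a b \<in> A"
    and one_closed: "one \<in> A"
    and meet_idem: "a \<in> A \<Longrightarrow> meet a a = a"
    and meet_commute: "\<lbrakk>a \<in> A; b \<in> A\<rbrakk> \<Longrightarrow> meet a b = meet b a"
    and meet_assoc: "\<lbrakk>a \<in> A; b \<in> A; c \<in> A\<rbrakk> \<Longrightarrow> meet (meet a b) c = meet a (meet b c)"
    and meet_one: "a \<in> A \<Longrightarrow> meet a one = a"

definition meet_le :: "('a \<Rightarrow> 'a \<Rightarrow> 'a) \<Rightarrow> 'a \<Rightarrow> 'a \<Rightarrow> bool"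
  where "meet_le meet a b \<longleftrightarrow> meet a b = a"

locale distributive_semilattice = meet_semilattice +
  assumes distributive:
    "\<lbrakk>a \<in> A; b \<in> A; c \<in> A; meet_le meet (meet a b) c\<rbrakk> \<Longrightarrow>
      \<exists>a1\<in>A. \<exists>b1\<in>A. meet_le meet a a1 \<and> meet_le meet b b1 \<and> c = meet a1 b1"

locale monotonic_distributive_semilattice = distributive_semilattice +
  fixes m :: "'a \<Rightarrow> 'a"
  assumes m_closed: "a \<in> A \<Longrightarrow> m a \<in> A"
    and m_mono: "\<lbrakk>a \<in> A; b \<in> A; meet_le meet a b\<rbrakk> \<Longrightarrow> meet_le meet (m a) (m b)"

definition mds_hom ::
  "'a set \<Rightarrow> ('a \<Rightarrow> 'a \<Rightarrow> 'a) \<Rightarrow> 'a \<Rightarrow> ('a \<Rightarrow> 'a) \<Rightarrow>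
   'b set \<Rightarrow> ('b \<Rightarrow> 'b \<Rightarrow> 'b) \<Rightarrow> 'b \<Rightarrow> ('b \<Rightarrow> 'b) \<Rightarrow> ('a \<Rightarrow> 'b) \<Rightarrow> bool"
  where "mds_hom A meet one m B meet' one' m' h \<longleftrightarrow>
    h ` A \<subseteq> B \<and>
    (\<forall>a\<in>A. \<forall>b\<in>A. h (meet a b) = meet' (h a) (h b)) \<and>
    h one = one' \<and>
    (\<forall>a\<in>A. h (m a) = m' (h a))"

definition is_filter :: "'a set \<Rightarrow> ('a \<Rightarrow> 'a \<Rightarrow> 'a) \<Rightarrow> 'a \<Rightarrow> 'a set \<Rightarrow> bool"
  where "is_filter A meet one F \<longleftrightarrow>
    F \<subseteq> A \<and>
    (\<forall>a\<in>F. \<forall>b\<in>A. meet_le meet a b \<longrightarrow> b \<in> F) \<and>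
    one \<in> F \<and>
    (\<forall>a\<in>F. \<forall>b\<in>F. meet a b \<in> F)"

definition irreducible_filters :: "'a set \<Rightarrow> ('a \<Rightarrow> 'a \<Rightarrow> 'a) \<Rightarrow> 'a \<Rightarrow> 'a set set"
  where "irreducible_filters A meet one =
    {P. is_filter A meet one P \<and> P \<noteq> A \<and>
        (\<forall>F1 F2. is_filter A meet one F1 \<longrightarrow> is_filter A meet one F2 \<longrightarrow>
           P = F1 \<inter> F2 \<longrightarrow> P = F1 \<or> P = F2)}"

definition beta :: "'a set \<Rightarrow> ('a \<Rightarrow> 'a \<Rightarrow> 'a) \<Rightarrow> 'a \<Rightarrow> 'a \<Rightarrow> 'a set set"
  where "beta A meet one a = {P \<in> irreducible_filters A meet one. a \<in> P}"

definition filter_topology :: "'a set \<Rightarrow> ('a \<Rightarrow> 'a \<Rightarrow> 'a) \<Rightarrow> 'a \<Rightarrow> 'a set topology"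
  where "filter_topology A meet one =
    topology_generated_by {irreducible_filters A meet one - beta A meet one a | a. a \<in> A}"

text \<open>The union of the generating sets is the whole space because irreducible filters are proper.\<close>

lemma topspace_filter_topology:
  "topspace (filter_topology A meet one) = irreducible_filters A meet one"
proof -
  let ?X = "irreducible_filters A meet one"
  have "\<Union> {?X - beta A meet one a | a. a \<in> A} = ?X"
  proof (intro equalityI subsetI)
    fix P assume P: "P \<in> ?X"
    then have "P \<subseteq> A" "P \<noteq> A"
      by (simp_all add: irreducible_filters_def is_filter_def)
    then obtain a where a: "a \<in> A" "a \<notin> P" by auto
    then have "P \<in> ?X - beta A meet one a"
      using P by (simp add: beta_def)
    with a(1) show "P \<in> \<Union> {?X - beta A meet one a | a. a \<in> A}" by auto
  qed auto
  then show ?thesis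
    by (simp add: filter_topology_def)
qed

definition compact_opens :: "'x topology \<Rightarrow> 'x set set"
  where "compact_opens T = {U. openin T U \<and> compactin T U}"

definition dually_directed :: "'x set set \<Rightarrow> bool"
  where "dually_directed L \<longleftrightarrow> (\<forall>U\<in>L. \<forall>V\<in>L. \<exists>W\<in>L. W \<subseteq> U \<inter> V)"

text \<open>Intersections are taken inside the space, so the empty family, which is vacuously dually
  directed, contributes the whole space.\<close>

definition directed_meets :: "'x topology \<Rightarrow> 'x set set"
  where "directed_meets T =
    {Z. \<exists>L. L \<subseteq> compact_opens T \<and> dually_directed L \<and> Z = topspace T \<inter> \<Inter> L}"

definition filter_upsets :: "'a set \<Rightarrow> ('a \<Rightarrow> 'a \<Rightarrow> 'a) \<Rightarrow> 'a \<Rightarrow> 'a set set set"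
  where "filter_upsets A meet one =
    {U. U \<subseteq> irreducible_filters A meet one \<and>
        (\<forall>P\<in>U. \<forall>Q\<in>irreducible_filters A meet one. P \<subseteq> Q \<longrightarrow> Q \<in> U)}"

definition ideal_of :: "'a set \<Rightarrow> ('a \<Rightarrow> 'a \<Rightarrow> 'a) \<Rightarrow> 'a \<Rightarrow> 'a set set \<Rightarrow> 'a set"
  where "ideal_of A meet one Z = {a \<in> A. beta A meet one a \<inter> Z = {}}"

definition multirel ::
  "'a set \<Rightarrow> ('a \<Rightarrow> 'a \<Rightarrow> 'a) \<Rightarrow> 'a \<Rightarrow> ('a \<Rightarrow> 'a) \<Rightarrow> ('a set \<times> 'a set set) set"
  where "multirel A meet one m =
    {(P, Z). P \<in> irreducible_filters A meet one \<and>
             Z \<in> directed_meets (filter_topology A meet one) \<and>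
             {a \<in> A. m a \<in> P} \<inter> ideal_of A meet one Z = {}}"

definition multirel_op ::
  "'a set \<Rightarrow> ('a \<Rightarrow> 'a \<Rightarrow> 'a) \<Rightarrow> 'a \<Rightarrow> ('a set \<times> 'a set set) set \<Rightarrow> 'a set set \<Rightarrow> 'a set set"
  where "multirel_op A meet one R U =
    {P \<in> irreducible_filters A meet one. \<forall>Z. (P, Z) \<in> R \<longrightarrow> Z \<inter> U \<noteq> {}}"

end

theory Submission imports Defs begin

text \<open>The inclusion of \<open>\<beta> (m a)\<close> in \<open>m\<^sub>R (\<beta> a)\<close> is immediate. For the converse, if \<open>m a \<notin> P\<close> then the
  complement \<open>Z\<close> of \<open>\<beta> a\<close> is a witness: it is compact open, it misses \<open>\<beta> a\<close>, and its ideal is the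
  set of elements below \<open>a\<close>, which is disjoint from the inverse image of \<open>P\<close> by monotonicity.
  Distributivity is what makes the complements of the sets \<open>\<beta> a\<close> a base and not only a subbase;
  compactness then reduces to the separation of points from filters by irreducible filters.\<close>

section \<open>Order and filters of a semilattice\<close>

context meet_semilattice
begin

lemma le_refl: "a \<in> A \<Longrightarrow> meet_le meet a a"
  by (simp add: meet_le_def meet_idem)

lemma le_trans:
  assumes "a \<in> A" "b \<in> A" "c \<in> A" "meet_le meet a b" "meet_le meet b c"
  shows "meet_le meet a c"
  using assms unfolding meet_le_def by (metis meet_assoc)

lemma le_antisym:
  assumes "a \<in> A" "b \<in> A" "meet_le meet a b" "meet_le meet b a"
  shows "a = b"
  using assms unfolding meet_le_def by (metis meet_commute)

lemma meet_le1:
  assumes "a \<in> A" "b \<in> A" shows "meet_le meet (meet a b) a"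
  using assms unfolding meet_le_def
  by (metis meet_assoc meet_closed meet_commute meet_idem)

lemma meet_le2:
  assumes "a \<in> A" "b \<in> A" shows "meet_le meet (meet a b) b"
  using assms unfolding meet_le_def by (metis meet_assoc meet_idem)

lemma le_meet:
  assumes "a \<in> A" "b \<in> A" "c \<in> A" "meet_le meet c a" "meet_le meet c b"
  shows "meet_le meet c (meet a b)"
  using assms unfolding meet_le_def by (metis meet_assoc)

lemma meet_mono:
  assumes "a \<in> A" "b \<in> A" "c \<in> A" "d \<in> A" "meet_le meet a c" "meet_le meet b d"
  shows "meet_le meet (meet a b) (meet c d)"
  using assms
  by (auto intro!: le_meet le_trans[OF _ _ _ meet_le1 assms(5)] le_trans[OF _ _ _ meet_le2 assms(6)]
        meet_closed)

lemma filter_subset: "is_filter A meet one F \<Longrightarrow> F \<subseteq> A"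
  by (simp add: is_filter_def)

lemma filter_upward: "\<lbrakk>is_filter A meet one F; a \<in> F; b \<in> A; meet_le meet a b\<rbrakk> \<Longrightarrow> b \<in> F"
  by (auto simp: is_filter_def)

lemma filter_one: "is_filter A meet one F \<Longrightarrow> one \<in> F"
  by (simp add: is_filter_def)

lemma filter_meet_iff:
  assumes "is_filter A meet one F" "a \<in> A" "b \<in> A"
  shows "meet a b \<in> F \<longleftrightarrow> a \<in> F \<and> b \<in> F"
proof
  assume "meet a b \<in> F"
  then show "a \<in> F \<and> b \<in> F"
    using filter_upward[OF assms(1) _ assms(2) meet_le1[OF assms(2,3)]]
      filter_upward[OF assms(1) _ assms(3) meet_le2[OF assms(2,3)]] by simp
next
  assume "a \<in> F \<and> b \<in> F"
  then show "meet a b \<in> F"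
    using assms(1) unfolding is_filter_def by blast
qed

lemma irreducible_filter: "P \<in> irreducible_filters A meet one \<Longrightarrow> is_filter A meet one P"
  by (simp add: irreducible_filters_def)

lemma principal_filter:
  assumes "a \<in> A"
  shows "is_filter A meet one {x \<in> A. meet_le meet a x}"
  unfolding is_filter_def
proof (intro conjI ballI impI)
  show "one \<in> {x \<in> A. meet_le meet a x}"
    using assms by (simp add: one_closed meet_le_def meet_one)
qed (use assms in \<open>auto intro: le_meet meet_closed le_trans[OF assms]\<close>)

text \<open>This is the filter generated by \<open>F\<close> and \<open>a\<close>. Two elements
  above \<open>meet p a\<close> and \<open>meet q a\<close> have their meet above
  \<open>meet (meet p q) a\<close>, and \<open>meet p q\<close> stays in \<open>F\<close>.\<close>

lemma filter_adjoin:
  assumes F: "is_filter A meet one F" and a: "a \<in> A"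
  shows "is_filter A meet one {x \<in> A. \<exists>p\<in>F. meet_le meet (meet p a) x}"
    (is "is_filter A meet one ?G")
proof -
  note FA = subsetD[OF filter_subset[OF F]]
  have "meet x y \<in> ?G" if xy: "x \<in> ?G" "y \<in> ?G" for x y
  proof -
    obtain p q where pq: "p \<in> F" "q \<in> F" "meet_le meet (meet p a) x" "meet_le meet (meet q a) y"
      using xy by auto
    have "meet_le meet (meet (meet p q) a) x"
      by (rule le_trans[OF _ _ _ meet_mono[of "meet p q" a p a] pq(3)])
        (use xy pq FA a in \<open>auto simp: meet_closed le_refl meet_le1\<close>)
    moreover have "meet_le meet (meet (meet p q) a) y"
      by (rule le_trans[OF _ _ _ meet_mono[of "meet p q" a q a] pq(4)])
        (use xy pq FA a in \<open>auto simp: meet_closed le_refl meet_le2\<close>)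
    ultimately have "meet_le meet (meet (meet p q) a) (meet x y)"
      using xy pq FA a by (auto intro!: le_meet meet_closed)
    moreover have "meet p q \<in> F"
      using F pq unfolding is_filter_def by blast
    ultimately show ?thesis
      using xy meet_closed by blast
  qed
  moreover have "one \<in> ?G"
    using filter_one[OF F] one_closed a meet_one[OF meet_closed[OF one_closed a]]
    by (auto simp: meet_le_def)
  moreover have "y \<in> ?G" if "x \<in> ?G" "y \<in> A" "meet_le meet x y" for x y
    using that a FA le_trans[OF meet_closed, of _ a x y] by blast
  ultimately show ?thesis
    unfolding is_filter_def by blast
qed

text \<open>By Zorn's lemma there is a maximal filter among those that contain \<open>F\<close> and
  omit \<open>a\<close>; such a filter is irreducible.\<close>

lemma filter_separation:
  assumes F: "is_filter A meet one F" and a: "a \<in> A" "a \<notin> F"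
  obtains P where "P \<in> irreducible_filters A meet one" "F \<subseteq> P" "a \<notin> P"
proof -
  define \<F> where "\<F> = {G. is_filter A meet one G \<and> F \<subseteq> G \<and> a \<notin> G}"
  have "\<exists>P\<in>\<F>. \<forall>G\<in>\<F>. P \<subseteq> G \<longrightarrow> G = P"
  proof (rule subset_Zorn_nonempty)
    show "\<F> \<noteq> {}"
      using F a by (auto simp: \<F>_def)
    fix \<C> assume ne: "\<C> \<noteq> {}" and ch: "subset.chain \<F> \<C>"
    have sub: "\<C> \<subseteq> \<F>" and tot: "\<And>G H. G \<in> \<C> \<Longrightarrow> H \<in> \<C> \<Longrightarrow> G \<subseteq> H \<or> H \<subseteq> G"
      using ch by (auto simp: subset_chain_def)
    have fil: "is_filter A meet one G" if "G \<in> \<C>" for G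
      using sub that by (auto simp: \<F>_def)
    have "meet x y \<in> \<Union>\<C>" if xy: "x \<in> \<Union>\<C>" "y \<in> \<Union>\<C>" for x y
    proof -
      obtain G where "G \<in> \<C>" "x \<in> G" "y \<in> G"
        using xy tot by blast
      then show ?thesis
        using fil[of G] unfolding is_filter_def by blast
    qed
    moreover have "one \<in> \<Union>\<C>"
      using ne fil by (auto simp: is_filter_def)
    ultimately have "is_filter A meet one (\<Union>\<C>)"
      using fil unfolding is_filter_def by blast
    then show "\<Union>\<C> \<in> \<F>"
      using ne sub by (auto simp: \<F>_def)
  qed
  then obtain P where P: "is_filter A meet one P" "F \<subseteq> P" "a \<notin> P"
    and max: "\<And>G. G \<in> \<F> \<Longrightarrow> P \<subseteq> G \<Longrightarrow> G = P"
    by (auto simp: \<F>_def)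
  \<comment> \<open>Since \<open>a\<close> is not in \<open>F1 \<inter> F2\<close>, one of the two
    filters omits \<open>a\<close>. It contains \<open>P\<close>, so it belongs to
    \<open>\<F>\<close> and equals \<open>P\<close> by maximality.\<close>
  have "P = F1 \<or> P = F2"
    if "is_filter A meet one F1" "is_filter A meet one F2" "P = F1 \<inter> F2" for F1 F2
    using that P max[of F1] max[of F2] by (auto simp: \<F>_def)
  then have "P \<in> irreducible_filters A meet one"
    using P a by (auto simp: irreducible_filters_def)
  then show ?thesis
    using that P by blast
qed

section \<open>The map \<open>beta\<close> as an order embedding\<close>

lemma beta_subset_iff:
  assumes "a \<in> A" "b \<in> A"
  shows "beta A meet one a \<subseteq> beta A meet one b \<longleftrightarrow> meet_le meet a b"
proof
  assume sub: "beta A meet one a \<subseteq> beta A meet one b"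
  show "meet_le meet a b"
  proof (rule ccontr)
    assume "\<not> meet_le meet a b"
    \<comment> \<open>The principal filter of \<open>a\<close> omits \<open>b\<close>, so an
      irreducible filter separates them.\<close>
    then obtain P where "P \<in> irreducible_filters A meet one" "{x \<in> A. meet_le meet a x} \<subseteq> P" "b \<notin> P"
      using filter_separation[OF principal_filter[OF assms(1)] assms(2)] by auto
    then show False
      using sub assms le_refl by (auto simp: beta_def)
  qed
next
  assume "meet_le meet a b"
  then show "beta A meet one a \<subseteq> beta A meet one b"
    using assms filter_upward[OF irreducible_filter] by (auto simp: beta_def)
qed

lemma inj_on_beta: "inj_on (beta A meet one) A"
  by (rule inj_onI, rule le_antisym) (simp_all flip: beta_subset_iff)

lemma beta_meet:
  "\<lbrakk>a \<in> A; b \<in> A\<rbrakk> \<Longrightarrow> beta A meet one (meet a b) = beta A meet one a \<inter> beta A meet one b"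
  unfolding beta_def using filter_meet_iff[OF irreducible_filter] by blast

lemma beta_one: "beta A meet one one = irreducible_filters A meet one"
  using filter_one[OF irreducible_filter] by (auto simp: beta_def)

lemma beta_in_filter_upsets: "beta A meet one a \<in> filter_upsets A meet one"
  by (auto simp: beta_def filter_upsets_def)

section \<open>The algebra of upsets\<close>

lemma distributive_semilattice_filter_upsets:
  "distributive_semilattice (filter_upsets A meet one) (\<inter>) (irreducible_filters A meet one)"
proof unfold_locales
  fix U V W
  assume "U \<in> filter_upsets A meet one" "V \<in> filter_upsets A meet one"
    "W \<in> filter_upsets A meet one" "meet_le (\<inter>) (U \<inter> V) W"
  \<comment> \<open>Upsets are closed under union, and \<open>U \<inter> V \<subseteq> W\<close>
    gives \<open>W\<close> = \<open>(U \<inter> V) \<union> W\<close>, to which the set-theoretic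
    distributive law applies.\<close>
  then have "U \<union> W \<in> filter_upsets A meet one" "V \<union> W \<in> filter_upsets A meet one"
    "W = (U \<union> W) \<inter> (V \<union> W)"
    by (auto simp: filter_upsets_def meet_le_def)
  moreover have "meet_le (\<inter>) U (U \<union> W)" "meet_le (\<inter>) V (V \<union> W)"
    by (auto simp: meet_le_def)
  ultimately show "\<exists>U1\<in>filter_upsets A meet one. \<exists>V1\<in>filter_upsets A meet one.
      meet_le (\<inter>) U U1 \<and> meet_le (\<inter>) V V1 \<and> W = U1 \<inter> V1"
    by blast
qed (auto simp: filter_upsets_def)

text \<open>Enlarging \<open>P\<close> to \<open>Q\<close> enlarges its inverse image under
  \<open>m\<close>, so every \<open>Z\<close> related to \<open>Q\<close> is already related to
  \<open>P\<close>.\<close>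

lemma multirel_op_in_filter_upsets:
  "multirel_op A meet one (multirel A meet one m) U \<in> filter_upsets A meet one"
  unfolding filter_upsets_def multirel_op_def multirel_def by blast

lemma multirel_op_mono: "U \<subseteq> V \<Longrightarrow> multirel_op A meet one R U \<subseteq> multirel_op A meet one R V"
  unfolding multirel_op_def by blast

end

section \<open>Irreducible filters and compact opens under distributivity\<close>

context distributive_semilattice
begin

text \<open>The complement of an irreducible filter is up-directed, hence an order ideal. If all
  common upper bounds of \<open>a\<close> and \<open>b\<close> lay in \<open>P\<close>, then
  \<open>P\<close> would be the intersection of the filters generated by adjoining \<open>a\<close>
  and \<open>b\<close> to it, both strictly larger.\<close>

lemma irreducible_filter_prime:
  assumes P: "P \<in> irreducible_filters A meet one"
    and ab: "a \<in> A" "b \<in> A" "a \<notin> P" "b \<notin> P"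
  obtains c where "c \<in> A" "c \<notin> P" "meet_le meet a c" "meet_le meet b c"
proof (rule ccontr)
  assume "\<not> thesis"
  then have upper: "\<And>c. c \<in> A \<Longrightarrow> meet_le meet a c \<Longrightarrow> meet_le meet b c \<Longrightarrow> c \<in> P"
    using that by blast
  note fP = irreducible_filter[OF P]
  note PA = subsetD[OF filter_subset[OF fP]]
  define G where "G d = {x \<in> A. \<exists>p\<in>P. meet_le meet (meet p d) x}" for d
  have filG: "is_filter A meet one (G d)" if "d \<in> A" for d
    unfolding G_def by (rule filter_adjoin[OF fP that])
  have PG: "P \<subseteq> G d" if "d \<in> A" for d
    unfolding G_def using that PA meet_le1 by blast
  have mem: "d \<in> G d" if "d \<in> A" for d
    unfolding G_def using that filter_one[OF fP] meet_le2 one_closed by blast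
  \<comment> \<open>Distributivity is applied twice: first \<open>x = meet p1 a1\<close>, then
    \<open>a1 = meet q2 b2\<close>. The factors \<open>p1\<close> and \<open>q2\<close> lie above
    elements of \<open>P\<close>, while \<open>b2\<close> is above \<open>b\<close> and also above
    \<open>a1\<close>, hence above \<open>a\<close>, so \<open>upper\<close> puts it in
    \<open>P\<close>.\<close>
  have "x \<in> P" if x: "x \<in> G a" "x \<in> G b" for x
  proof -
    obtain p q where pq: "p \<in> P" "q \<in> P" "x \<in> A"
        "meet_le meet (meet p a) x" "meet_le meet (meet q b) x"
      using x by (auto simp: G_def)
    obtain p1 a1 where 1: "p1 \<in> A" "a1 \<in> A" "meet_le meet p p1" "meet_le meet a a1" "x = meet p1 a1"
      using distributive[OF PA[OF pq(1)] ab(1) pq(3,4)] by blast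
    have "meet_le meet (meet q b) a1"
      by (rule le_trans[OF _ _ _ pq(5)]) (use 1 pq PA ab in \<open>auto simp: meet_closed meet_le2\<close>)
    then obtain q2 b2 where 2: "q2 \<in> A" "b2 \<in> A" "meet_le meet q q2" "meet_le meet b b2" "a1 = meet q2 b2"
      using distributive[OF PA[OF pq(2)] ab(2) 1(2)] by blast
    have "meet_le meet a b2"
      by (rule le_trans[OF _ _ _ 1(4)]) (use 1 2 ab in \<open>auto simp: meet_le2\<close>)
    then have "b2 \<in> P"
      using upper 2 by blast
    moreover have "p1 \<in> P" "q2 \<in> P"
      using filter_upward[OF fP] pq 1 2 by blast+
    ultimately show "x \<in> P"
      using filter_meet_iff[OF fP] 1 2 by simp
  qed
  then have "P = G a \<inter> G b"
    using PG ab by blast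
  then have "P = G a \<or> P = G b"
    using P filG ab unfolding irreducible_filters_def by blast
  then show False
    using mem ab by blast
qed

text \<open>The case that needs an argument is a binary intersection: a common upper bound of
  \<open>a\<close> and \<open>b\<close> outside \<open>P\<close> gives a basic neighbourhood of
  \<open>P\<close> inside both basic sets.\<close>

lemma filter_topology_base:
  assumes "openin (filter_topology A meet one) U" "P \<in> U"
  obtains c where "c \<in> A" "c \<notin> P" "irreducible_filters A meet one - beta A meet one c \<subseteq> U"
proof -
  let ?X = "irreducible_filters A meet one"
  have UX: "U \<subseteq> ?X"
    using openin_subset[OF assms(1)] by (simp add: topspace_filter_topology)
  have "generate_topology_on {?X - beta A meet one a | a. a \<in> A} U"
    using assms(1) unfolding filter_topology_def by (rule openin_topology_generated_by)
  \<comment> \<open>Intersecting with \<open>?X\<close> keeps the irreducibility of \<open>P\<close>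
    available inside the induction.\<close>
  then have "\<forall>P\<in>U \<inter> ?X. \<exists>c\<in>A. c \<notin> P \<and> ?X - beta A meet one c \<subseteq> U"
  proof induction
    case (Int U V)
    show ?case
    proof
      fix P assume P: "P \<in> (U \<inter> V) \<inter> ?X"
      obtain a b where ab: "a \<in> A" "a \<notin> P" "?X - beta A meet one a \<subseteq> U"
          "b \<in> A" "b \<notin> P" "?X - beta A meet one b \<subseteq> V"
        using bspec[OF Int.IH(1), of P] bspec[OF Int.IH(2), of P] P by auto
      obtain c where c: "c \<in> A" "c \<notin> P" "meet_le meet a c" "meet_le meet b c"
        by (rule irreducible_filter_prime[OF IntD2[OF P] ab(1,4,2,5)])
      then have "beta A meet one a \<subseteq> beta A meet one c" "beta A meet one b \<subseteq> beta A meet one c"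
        using ab by (simp_all add: beta_subset_iff)
      then show "\<exists>c\<in>A. c \<notin> P \<and> ?X - beta A meet one c \<subseteq> U \<inter> V"
        using ab c by blast
    qed
  next
    case (UN K)
    show ?case
    proof
      fix P assume "P \<in> \<Union> K \<inter> ?X"
      then obtain U where "U \<in> K" "P \<in> U \<inter> ?X"
        by blast
      then obtain c where "c \<in> A" "c \<notin> P" "?X - beta A meet one c \<subseteq> U"
        using UN.IH by blast
      then show "\<exists>c\<in>A. c \<notin> P \<and> ?X - beta A meet one c \<subseteq> \<Union> K"
        using \<open>U \<in> K\<close> by blast
    qed
  next
    case (Basis s)
    then obtain a where a: "a \<in> A" "s = ?X - beta A meet one a"
      by blast
    show ?case
    proof
      fix P assume "P \<in> s \<inter> ?X"
      then have "a \<notin> P"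
        using a by (simp add: beta_def)
      then show "\<exists>c\<in>A. c \<notin> P \<and> ?X - beta A meet one c \<subseteq> s"
        using a by blast
    qed
  qed simp
  moreover have "P \<in> U \<inter> ?X"
    using assms(2) UX by blast
  ultimately have "\<exists>c\<in>A. c \<notin> P \<and> ?X - beta A meet one c \<subseteq> U"
    by (rule bspec)
  then show ?thesis
    by (elim bexE conjE) (rule that)
qed

lemma compactin_complement_beta:
  assumes a: "a \<in> A"
  shows "compactin (filter_topology A meet one) (irreducible_filters A meet one - beta A meet one a)"
    (is "compactin ?T (?X - _)")
  unfolding compactin_def
proof (intro conjI allI impI)
  show "?X - beta A meet one a \<subseteq> topspace ?T"
    by (auto simp: topspace_filter_topology)
  fix \<U> assume "Ball \<U> (openin ?T) \<and> ?X - beta A meet one a \<subseteq> \<Union> \<U>"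
  then have op: "\<And>U. U \<in> \<U> \<Longrightarrow> openin ?T U" and cov: "?X - beta A meet one a \<subseteq> \<Union> \<U>"
    by auto
  \<comment> \<open>The elements whose basic open set has a finite subcover form a filter;
    compactness for \<open>a\<close> is the claim \<open>a \<in> F\<close>.\<close>
  define F where "F = {x \<in> A. \<exists>\<V>. finite \<V> \<and> \<V> \<subseteq> \<U> \<and> ?X - beta A meet one x \<subseteq> \<Union> \<V>}"
  have "is_filter A meet one F"
    unfolding is_filter_def
  proof (intro conjI ballI impI)
    show "one \<in> F"
      unfolding F_def using one_closed beta_one by auto
  next
    fix x y assume "x \<in> F" "y \<in> A" "meet_le meet x y"
    moreover from this have "beta A meet one x \<subseteq> beta A meet one y"
      by (simp add: F_def beta_subset_iff)
    ultimately show "y \<in> F"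
      unfolding F_def by blast
  next
    fix x y assume xy: "x \<in> F" "y \<in> F"
    obtain \<V> \<W> where "finite \<V>" "\<V> \<subseteq> \<U>" "?X - beta A meet one x \<subseteq> \<Union> \<V>"
        "finite \<W>" "\<W> \<subseteq> \<U>" "?X - beta A meet one y \<subseteq> \<Union> \<W>"
      using xy unfolding F_def by blast
    then have "finite (\<V> \<union> \<W>)" "\<V> \<union> \<W> \<subseteq> \<U>" "?X - beta A meet one (meet x y) \<subseteq> \<Union> (\<V> \<union> \<W>)"
      using xy by (auto simp: F_def beta_meet)
    then show "meet x y \<in> F"
      using xy meet_closed unfolding F_def by blast
  qed (auto simp: F_def)
  \<comment> \<open>A point \<open>P\<close> that contains \<open>F\<close> and omits
    \<open>a\<close> lies in some member \<open>U\<close> of the cover. A basic neighbourhood of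
    \<open>P\<close> inside \<open>U\<close>, given by \<open>c\<close>, is covered by
    \<open>{U}\<close> alone, so \<open>c \<in> F\<close> although
    \<open>c \<notin> P\<close>.\<close>
  moreover have False if P: "P \<in> ?X" "F \<subseteq> P" "a \<notin> P" for P
  proof -
    obtain U where U: "U \<in> \<U>" "P \<in> U"
      using P cov by (auto simp: beta_def)
    then obtain c where "c \<in> A" "c \<notin> P" "?X - beta A meet one c \<subseteq> U"
      using filter_topology_base op by blast
    moreover from this have "c \<in> F"
      unfolding F_def using U by (auto intro!: exI[of _ "{U}"])
    ultimately show False
      using P by blast
  qed
  ultimately have "a \<in> F"
    using filter_separation a by blast
  then show "\<exists>\<F>. finite \<F> \<and> \<F> \<subseteq> \<U> \<and> ?X - beta A meet one a \<subseteq> \<Union> \<F>"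
    by (simp add: F_def)
qed

lemma complement_beta_in_directed_meets:
  assumes "a \<in> A"
  shows "irreducible_filters A meet one - beta A meet one a
           \<in> directed_meets (filter_topology A meet one)"
    (is "?Z \<in> directed_meets ?T")
proof -
  have "openin ?T ?Z"
    unfolding filter_topology_def using assms by (auto intro!: topology_generated_by_Basis)
  \<comment> \<open>A compact open set is the intersection of the directed family consisting of
    itself.\<close>
  then have "{?Z} \<subseteq> compact_opens ?T" "dually_directed {?Z}" "?Z = topspace ?T \<inter> \<Inter> {?Z}"
    using compactin_complement_beta[OF assms]
    by (auto simp: compact_opens_def dually_directed_def topspace_filter_topology)
  then show ?thesis
    unfolding directed_meets_def by blast
qed

end

section \<open>Compatibility of \<open>beta\<close> with the monotone operation\<close>

context monotonic_distributive_semilattice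
begin

lemma beta_m:
  assumes a: "a \<in> A"
  shows "beta A meet one (m a) = multirel_op A meet one (multirel A meet one m) (beta A meet one a)"
    (is "_ = ?M")
proof
  show "beta A meet one (m a) \<subseteq> ?M"
    using a by (auto simp: beta_def multirel_op_def multirel_def ideal_of_def)
  show "?M \<subseteq> beta A meet one (m a)"
  proof
    fix P assume PM: "P \<in> ?M"
    let ?Z = "irreducible_filters A meet one - beta A meet one a"
    from PM have P: "P \<in> irreducible_filters A meet one"
      and "(P, ?Z) \<notin> multirel A meet one m"
      by (auto simp: multirel_op_def)
    \<comment> \<open>Since \<open>?Z\<close> is an admissible second component, the pair can fail
      to be related only through some \<open>b\<close> with \<open>m b \<in> P\<close> in the ideal
      of \<open>?Z\<close>.\<close>
    then obtain b where b: "b \<in> A" "m b \<in> P" "beta A meet one b \<inter> ?Z = {}"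
      using complement_beta_in_directed_meets[OF a] by (auto simp: multirel_def ideal_of_def)
    then have "beta A meet one b \<subseteq> beta A meet one a"
      by (auto simp: beta_def)
    then have "meet_le meet (m b) (m a)"
      using a b m_mono beta_subset_iff by blast
    then have "m a \<in> P"
      using filter_upward[OF irreducible_filter[OF P]] a b m_closed by blast
    then show "P \<in> beta A meet one (m a)"
      using P by (simp add: beta_def)
  qed
qed

end

theorem mainTheorem1:
  fixes A :: "'a set" and meet :: "'a \<Rightarrow> 'a \<Rightarrow> 'a" and one :: 'a and m :: "'a \<Rightarrow> 'a"
  assumes "monotonic_distributive_semilattice A meet one m"
  shows "monotonic_distributive_semilattice
           (filter_upsets A meet one) (\<inter>) (irreducible_filters A meet one)
           (multirel_op A meet one (multirel A meet one m))
       \<and> mds_hom A meet one m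
           (filter_upsets A meet one) (\<inter>) (irreducible_filters A meet one)
           (multirel_op A meet one (multirel A meet one m))
           (beta A meet one)
       \<and> inj_on (beta A meet one) A"
proof -
  interpret monotonic_distributive_semilattice A meet one m by fact
  \<comment> \<open>For \<open>(\<inter>)\<close> the order \<open>meet_le\<close> is inclusion, so
    monotonicity is \<open>multirel_op_mono\<close>.\<close>
  have "monotonic_distributive_semilattice
      (filter_upsets A meet one) (\<inter>) (irreducible_filters A meet one)
      (multirel_op A meet one (multirel A meet one m))"
    using distributive_semilattice_filter_upsets multirel_op_in_filter_upsets multirel_op_mono
    by (simp add: monotonic_distributive_semilattice_def
        monotonic_distributive_semilattice_axioms_def meet_le_def Int_absorb2 flip: inf.absorb_iff1)
  then show ?thesis
    by (auto simp: mds_hom_def beta_in_filter_upsets beta_meet beta_one beta_m inj_on_beta)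
qed

end
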